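(* Let $I$ be a finite index set, let $\{\tau_i\}_{i\in I}$ be a contractive iterated function system (IFS) on $\mathbb{R}$, and let $\{p_i\}_{i\in I}$ be probability weights with $p_i\in(0,1)$ and $\sum_{i\in I}p_i=1$. Then there exists a unique moment matrix $M^{(\mu)}$ of a probability measure $\mu$ which satisfies $$\mathcal{R}(M^{(\mu)})=M^{(\mu)},\qquad\text{i.e.}\qquad M^{(\sum_{i\in I}p_i(\mu\circ\tau_i^{-1}))}=M^{(\mu)}.$$ This unique solution is exactly the moment matrix of the Hutchinson equilibrium measure of the IFS. Furthermore, for any Borel regular probability measure $\nu$ supported on the attractor set $X$ of the IFS, $\mathcal{R}^n(M^{(\nu)})$ converges componentwise to $M^{(\mu)}$ as $n\to\infty$.
   Context: A contractive IFS on $\mathbb{R}$ is a finite family of maps $\tau_i:\mathbb{R}\to\mathbb{R}$, each Lipschitz with constant strictly less than $1$. Its attractor $X$ is the unique nonempty compact set with $X=\bigcup_{i\in I}\tau_i(X)$, and its Hutchinson equilibrium measure is the unique Borel probability measure $\mu$ on $\mathbb{R}$ (supported on $X$) with $\mu=\sum_{i\in I}p_i(\mu\circ\tau_i^{-1})$. For a Borel measure $\nu$ on $\mathbb{R}$ with finite moments of all orders, the moment matrix $M^{(\nu)}$ is the infinite matrix with entries $M^{(\nu)}_{i,j}=\int_{\mathbb{R}}x^{i+j}\,\mathrm{d}\nu(x)$, $i,j\in\mathbb{N}_0$. The transformation $\mathcal{R}$ is $\mathcal{R}:M^{(\nu)}\mapsto M^{(\sum_{i\in I}p_i(\nu\circ\tau_i^{-1}))}$,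 and $\mathcal{R}^n(M^{(\nu)})=M^{(S^n\nu)}$ with $S\nu=\sum_{i\in I}p_i(\nu\circ\tau_i^{-1})$. *)

theory Defs
  imports "HOL-Probability.Probability"
begin

definition contractive_ifs :: "'i set \<Rightarrow> ('i \<Rightarrow> real \<Rightarrow> real) \<Rightarrow> bool" where
  "contractive_ifs I \<tau> \<longleftrightarrow> finite I \<and> (\<forall>i\<in>I. \<exists>c<1. c-lipschitz_on UNIV (\<tau> i))"

definition is_attractor :: "'i set \<Rightarrow> ('i \<Rightarrow> real \<Rightarrow> real) \<Rightarrow> real set \<Rightarrow> bool" where
  "is_attractor I \<tau> X \<longleftrightarrow> compact X \<and> X \<noteq> {} \<and> X = (\<Union>i\<in>I. \<tau> i ` X)"

definition attractor :: "'i set \<Rightarrow> ('i \<Rightarrow> real \<Rightarrow> real) \<Rightarrow> real set" where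
  "attractor I \<tau> = (THE X. is_attractor I \<tau> X)"

definition borel_prob :: "real measure \<Rightarrow> bool" where
  "borel_prob \<nu> \<longleftrightarrow> prob_space \<nu> \<and> sets \<nu> = sets borel"

(* The measure \<Sum>i\<in>I. p i * (\<nu> \<circ> (\<tau> i)^{-1}). The set function below is countably additive
   for all arguments, so measure_of never falls back to the zero measure; see
   emeasure_hutchinson_op. *)
definition hutchinson_op ::
  "'i set \<Rightarrow> ('i \<Rightarrow> real) \<Rightarrow> ('i \<Rightarrow> real \<Rightarrow> real) \<Rightarrow> real measure \<Rightarrow> real measure" where
  "hutchinson_op I p \<tau> \<nu> =
     measure_of UNIV (sets borel) (\<lambda>A. \<Sum>i\<in>I. ennreal (p i) * emeasure (distr \<nu> borel (\<tau> i)) A)"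

lemma sets_hutchinson_op [simp]: "sets (hutchinson_op I p \<tau> \<nu>) = sets borel"
  unfolding hutchinson_op_def by (metis sets.sets_measure_of_eq space_borel)

lemma emeasure_hutchinson_op:
  assumes "A \<in> sets borel"
  shows "emeasure (hutchinson_op I p \<tau> \<nu>) A =
           (\<Sum>i\<in>I. ennreal (p i) * emeasure (distr \<nu> borel (\<tau> i)) A)"
proof (rule emeasure_measure_of[OF hutchinson_op_def])
  let ?f = "\<lambda>A. \<Sum>i\<in>I. ennreal (p i) * emeasure (distr \<nu> borel (\<tau> i)) A"
  show "positive (sets (hutchinson_op I p \<tau> \<nu>)) ?f"
    by (simp add: positive_def)
  show "countably_additive (sets (hutchinson_op I p \<tau> \<nu>)) ?f"
  proof (rule countably_additiveI)
    fix F :: "nat \<Rightarrow> real set"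
    assume F: "range F \<subseteq> sets (hutchinson_op I p \<tau> \<nu>)" "disjoint_family F"
    have "(\<Sum>n. ?f (F n)) = (\<Sum>i\<in>I. \<Sum>n. ennreal (p i) * emeasure (distr \<nu> borel (\<tau> i)) (F n))"
      by (rule suminf_sum) simp
    also have "\<dots> = (\<Sum>i\<in>I. ennreal (p i) * (\<Sum>n. emeasure (distr \<nu> borel (\<tau> i)) (F n)))"
      by simp
    also have "\<dots> = ?f (\<Union>n. F n)"
      using F by (intro sum.cong refl arg_cong2[where f = "(*)"] suminf_emeasure) auto
    finally show "(\<Sum>n. ?f (F n)) = ?f (\<Union>n. F n)" .
  qed
qed (use assms in auto)

definition is_hutchinson_measure ::
  "'i set \<Rightarrow> ('i \<Rightarrow> real) \<Rightarrow> ('i \<Rightarrow> real \<Rightarrow> real) \<Rightarrow> real measure \<Rightarrow> bool" where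
  "is_hutchinson_measure I p \<tau> \<mu> \<longleftrightarrow>
     borel_prob \<mu> \<and> emeasure \<mu> (- attractor I \<tau>) = 0 \<and> hutchinson_op I p \<tau> \<mu> = \<mu>"

definition hutchinson_measure ::
  "'i set \<Rightarrow> ('i \<Rightarrow> real) \<Rightarrow> ('i \<Rightarrow> real \<Rightarrow> real) \<Rightarrow> real measure" where
  "hutchinson_measure I p \<tau> = (THE \<mu>. is_hutchinson_measure I p \<tau> \<mu>)"

definition has_all_moments :: "real measure \<Rightarrow> bool" where
  "has_all_moments \<nu> \<longleftrightarrow> (\<forall>k::nat. integrable \<nu> (\<lambda>x. x ^ k))"

(* Meaningful only under has_all_moments: the Bochner integral of a non-integrable function is 0. *)
definition moment_matrix :: "real measure \<Rightarrow> nat \<Rightarrow> nat \<Rightarrow> real" where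
  "moment_matrix \<nu> i j = (\<integral>x. x ^ (i + j) \<partial>\<nu>)"

(* The transformation R, as the set of all pairs (M^(\<nu>), M^(S \<nu>)) with S = hutchinson_op I p \<tau>.
   It is a relation because \<tau> i need not be affine: two measures with the same moments may then
   have images under S with different moments, so M^(S \<nu>) is not in general a function of M^(\<nu>).
   A fixed point of R is an M with (M, M) in this relation, i.e. M = M^(\<mu>) = M^(S \<mu>) for some
   probability measure \<mu>. *)
definition moment_transform ::
  "'i set \<Rightarrow> ('i \<Rightarrow> real) \<Rightarrow> ('i \<Rightarrow> real \<Rightarrow> real) \<Rightarrow>
     ((nat \<Rightarrow> nat \<Rightarrow> real) \<times> (nat \<Rightarrow> nat \<Rightarrow> real)) set" where
  "moment_transform I p \<tau> =
     {(moment_matrix \<nu>, moment_matrix (hutchinson_op I p \<tau> \<nu>)) | \<nu>.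
        borel_prob \<nu> \<and> has_all_moments \<nu>}"

(* Holds for every finite Borel measure on the reals. *)
definition regular_borel :: "real measure \<Rightarrow> bool" where
  "regular_borel \<nu> \<longleftrightarrow> sets \<nu> = sets borel \<and>
     (\<forall>A\<in>sets borel.
        emeasure \<nu> A = (SUP K\<in>{K. K \<subseteq> A \<and> compact K}. emeasure \<nu> K) \<and>
        emeasure \<nu> A = (INF U\<in>{U. A \<subseteq> U \<and> open U}. emeasure \<nu> U))"

end

theory Submission
  imports Defs
begin

text \<open>
  Choose \<open>c < 1\<close> and \<open>R\<close> with \<open>\<bar>\<tau> i x\<bar> \<le> c * \<bar>x\<bar> + (1 - c) * R\<close> for all \<open>i\<close>. If \<open>\<nu>\<close> and \<open>S \<nu>\<close> have the same
  moments, convexity of \<open>t ^ (2 * k)\<close> gives \<open>m (2 * k) \<le> c * m (2 * k) + (1 - c) * R ^ (2 * k)\<close>,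
  hence \<open>m (2 * k) \<le> R ^ (2 * k)\<close> for every \<open>k\<close>, and \<open>\<nu>\<close> lives on \<open>[-R, R]\<close>. There measures are
  determined by their moments (Weierstrass approximation and characteristic functions), so
  \<open>S \<nu> = \<nu>\<close>. In the same way a measure on \<open>[-R, R]\<close> is the only one with its moment matrix, which
  makes the relation \<open>moment_transform\<close> single-valued along the orbits in question.

  If \<open>f\<close> is \<open>L\<close>-Lipschitz on \<open>[-R, R]\<close>, then \<open>\<integral>f d(S \<nu>) = \<integral>g d\<nu>\<close> with \<open>g = (\<Sum>i. p i * (f \<circ> \<tau> i))\<close> being
  \<open>c * L\<close>-Lipschitz, so integrals against \<open>S ^^ n\<close> of two probability measures on \<open>[-R, R]\<close>
  approach each other geometrically. This yields convergence and uniqueness. Existence comes from the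
  coding map \<open>\<omega> \<mapsto> lim \<tau> (\<omega> 0) (\<dots> (\<tau> (\<omega> n) 0))\<close> on streams of symbols: the closure of
  its range is the attractor, and the image of the product measure with weights \<open>p\<close> is invariant.
\<close>

section \<open>Integration against the Hutchinson operator\<close>

lemma borel_prob_iff: "borel_prob \<nu> \<longleftrightarrow> real_distribution \<nu>"
  by (auto simp: borel_prob_def real_distribution_def real_distribution_axioms_def)

lemma nn_integral_hutchinson_op:
  assumes [measurable]: "f \<in> borel_measurable borel" "\<And>i. i \<in> I \<Longrightarrow> \<tau> i \<in> borel_measurable borel"
    and [measurable_cong]: "sets \<nu> = sets borel"
  shows "(\<integral>\<^sup>+x. f x \<partial>hutchinson_op I p \<tau> \<nu>) = (\<Sum>i\<in>I. ennreal (p i) * (\<integral>\<^sup>+x. f (\<tau> i x) \<partial>\<nu>))"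
proof -
  have [measurable_cong]: "sets (hutchinson_op I p \<tau> \<nu>) = sets borel"
    by simp
  have "(\<integral>\<^sup>+x. f x \<partial>hutchinson_op I p \<tau> \<nu>)
      = (\<Sum>i\<in>I. ennreal (p i) * (\<integral>\<^sup>+x. f x \<partial>distr \<nu> borel (\<tau> i)))"
    using assms(1)
  proof (induction rule: borel_measurable_induct)
    case (cong f g)
    then show ?case by simp
  next
    case (set A)
    then show ?case by (simp add: emeasure_hutchinson_op)
  next
    case (mult u c)
    then show ?case
      by (simp add: nn_integral_cmult sum_distrib_left mult.left_commute)
  next
    case (add u v)
    then show ?case
      by (simp add: nn_integral_add sum.distrib distrib_left)
  next
    case (seq U)
    have mono: "incseq (\<lambda>j. ennreal (p i) * (\<integral>\<^sup>+x. U j x \<partial>distr \<nu> borel (\<tau> i)))" for i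
      using seq(3) by (intro monoI mult_left_mono nn_integral_mono) (auto simp: incseq_def le_fun_def)
    have "(\<integral>\<^sup>+x. (SUP j. U j x) \<partial>hutchinson_op I p \<tau> \<nu>)
        = (SUP j. \<integral>\<^sup>+x. U j x \<partial>hutchinson_op I p \<tau> \<nu>)"
      using seq by (intro nn_integral_monotone_convergence_SUP) auto
    also have "\<dots> = (SUP j. \<Sum>i\<in>I. ennreal (p i) * (\<integral>\<^sup>+x. U j x \<partial>distr \<nu> borel (\<tau> i)))"
      using seq by simp
    also have "\<dots> = (\<Sum>i\<in>I. SUP j. ennreal (p i) * (\<integral>\<^sup>+x. U j x \<partial>distr \<nu> borel (\<tau> i)))"
      by (rule ennreal_SUP_sum[OF mono])
    also have "\<dots> = (\<Sum>i\<in>I. ennreal (p i) * (\<integral>\<^sup>+x. (SUP j. U j x) \<partial>distr \<nu> borel (\<tau> i)))"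
      using seq by (simp add: nn_integral_monotone_convergence_SUP SUP_mult_left_ennreal)
    finally show ?case
      by (simp add: SUP_apply[abs_def] image_comp)
  qed
  also have "\<dots> = (\<Sum>i\<in>I. ennreal (p i) * (\<integral>\<^sup>+x. f (\<tau> i x) \<partial>\<nu>))"
    by (intro sum.cong refl arg_cong2[where f = "(*)"] nn_integral_distr) measurable
  finally show ?thesis .
qed

lemma
  fixes f :: "real \<Rightarrow> real"
  assumes [measurable]: "f \<in> borel_measurable borel" "\<And>i. i \<in> I \<Longrightarrow> \<tau> i \<in> borel_measurable borel"
    and [measurable_cong]: "sets \<nu> = sets borel"
    and p: "\<And>i. i \<in> I \<Longrightarrow> 0 \<le> p i"
    and int: "\<And>i. i \<in> I \<Longrightarrow> integrable \<nu> (\<lambda>x. f (\<tau> i x))"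
  shows integrable_hutchinson_op: "integrable (hutchinson_op I p \<tau> \<nu>) f"
    and integral_hutchinson_op:
      "(\<integral>x. f x \<partial>hutchinson_op I p \<tau> \<nu>) = (\<Sum>i\<in>I. p i * (\<integral>x. f (\<tau> i x) \<partial>\<nu>))"
proof -
  have [measurable_cong]: "sets (hutchinson_op I p \<tau> \<nu>) = sets borel"
    by simp
  have fin: "(\<integral>\<^sup>+x. ennreal (f (\<tau> i x)) \<partial>\<nu>) < top" "(\<integral>\<^sup>+x. ennreal (- f (\<tau> i x)) \<partial>\<nu>) < top"
    if "i \<in> I" for i
    using int[OF that] by (auto simp: real_integrable_def less_top)
  have "(\<integral>\<^sup>+x. ennreal (norm (f x)) \<partial>hutchinson_op I p \<tau> \<nu>)
      = (\<Sum>i\<in>I. ennreal (p i) * (\<integral>\<^sup>+x. ennreal (norm (f (\<tau> i x))) \<partial>\<nu>))"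
    by (rule nn_integral_hutchinson_op) (simp_all add: assms(2,3))
  also have "\<dots> < \<infinity>"
    using int by (cases "finite I") (auto simp: ennreal_mult_less_top integrable_iff_bounded)
  finally show f: "integrable (hutchinson_op I p \<tau> \<nu>) f"
    by (simp add: integrable_iff_bounded)
  \<comment> \<open>\<open>enn2real\<close> sends \<open>top\<close> to 0, so it commutes with these
    sums only when every term is finite; \<open>fin\<close> supplies this for the positive and
    negative parts.\<close>
  have *: "enn2real (\<Sum>i\<in>I. ennreal (p i) * u i) = (\<Sum>i\<in>I. p i * enn2real (u i))"
    if "\<And>i. i \<in> I \<Longrightarrow> u i < top" for u
    using that p by (subst enn2real_sum) (auto simp: ennreal_mult_less_top enn2real_mult)
  have 1: "enn2real (\<integral>\<^sup>+x. ennreal (f x) \<partial>hutchinson_op I p \<tau> \<nu>)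
      = (\<Sum>i\<in>I. p i * enn2real (\<integral>\<^sup>+x. ennreal (f (\<tau> i x)) \<partial>\<nu>))"
    by (subst nn_integral_hutchinson_op[OF _ assms(2,3)]) (simp_all add: * fin)
  have 2: "enn2real (\<integral>\<^sup>+x. ennreal (- f x) \<partial>hutchinson_op I p \<tau> \<nu>)
      = (\<Sum>i\<in>I. p i * enn2real (\<integral>\<^sup>+x. ennreal (- f (\<tau> i x)) \<partial>\<nu>))"
    by (subst nn_integral_hutchinson_op[OF _ assms(2,3)]) (simp_all add: * fin)
  show "(\<integral>x. f x \<partial>hutchinson_op I p \<tau> \<nu>) = (\<Sum>i\<in>I. p i * (\<integral>x. f (\<tau> i x) \<partial>\<nu>))"
    unfolding real_lebesgue_integral_def[OF f] 1 2
    by (simp add: real_lebesgue_integral_def[OF int] sum_subtractf right_diff_distrib)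
qed

lemma AE_hutchinson_op:
  assumes [measurable]: "Measurable.pred borel P" "\<And>i. i \<in> I \<Longrightarrow> \<tau> i \<in> borel_measurable borel"
    and [measurable_cong]: "sets \<nu> = sets borel"
    and AE: "\<And>i. i \<in> I \<Longrightarrow> AE x in \<nu>. P (\<tau> i x)"
  shows "AE x in hutchinson_op I p \<tau> \<nu>. P x"
proof (rule AE_I)
  have *: "emeasure (distr \<nu> borel (\<tau> i)) {x. \<not> P x} = 0" if "i \<in> I" for i
  proof -
    have [measurable]: "\<tau> i \<in> borel_measurable borel"
      by (rule assms(2)) fact
    have "emeasure \<nu> {x \<in> space \<nu>. \<not> P (\<tau> i x)} = 0"
      using AE[OF that] by (subst (asm) AE_iff_measurable[OF _ refl]) auto
    then show ?thesis
      by (subst emeasure_distr) (auto simp: vimage_def Int_def conj_commute)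
  qed
  show "emeasure (hutchinson_op I p \<tau> \<nu>) {x. \<not> P x} = 0"
    by (simp add: emeasure_hutchinson_op *)
qed auto

section \<open>Moments of measures on a bounded interval\<close>

lemma integrable_continuous_AE_bounded:
  fixes g :: "real \<Rightarrow> real"
  assumes M: "real_distribution M" "AE x in M. \<bar>x\<bar> \<le> R" and g: "continuous_on UNIV g"
  shows "integrable M g"
proof -
  interpret M: real_distribution M by fact
  have "compact (g ` {-R..R})"
    using g by (intro compact_continuous_image compact_Icc) (auto intro: continuous_on_subset)
  then obtain B where B: "\<forall>x\<in>{-R..R}. \<bar>g x\<bar> \<le> B"
    using compact_imp_bounded[of "g ` {-R..R}"] by (auto simp: bounded_iff)
  have "AE x in M. norm (g x) \<le> B"
    using M(2) by eventually_elim (use B in \<open>auto simp: abs_le_iff\<close>)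
  moreover have [measurable]: "g \<in> borel_measurable borel"
    using g by (rule borel_measurable_continuous_onI)
  ultimately show ?thesis
    by (intro M.integrable_const_bound[of _ B]) auto
qed

lemma integral_eq_if_moments_eq:
  fixes f :: "real \<Rightarrow> real"
  assumes \<nu>: "real_distribution \<nu>" "AE x in \<nu>. \<bar>x\<bar> \<le> R"
    and \<nu>': "real_distribution \<nu>'" "AE x in \<nu>'. \<bar>x\<bar> \<le> R"
    and mom: "\<And>k. (\<integral>x. x ^ k \<partial>\<nu>) = (\<integral>x. x ^ k \<partial>\<nu>')"
    and f: "continuous_on UNIV f"
  shows "(\<integral>x. f x \<partial>\<nu>) = (\<integral>x. f x \<partial>\<nu>')"
proof -
  have "\<bar>(\<integral>x. f x \<partial>\<nu>) - (\<integral>x. f x \<partial>\<nu>')\<bar> \<le> 2 * e" if e: "e > 0" for e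
  proof -
    obtain g where g: "real_polynomial_function g" "\<And>x. x \<in> {-R..R} \<Longrightarrow> \<bar>f x - g x\<bar> < e"
      using Stone_Weierstrass_real_polynomial_function[of "{-R..R}" f e] e f
      by (metis compact_Icc continuous_on_subset subset_UNIV)
    obtain a n where gs: "g = (\<lambda>x. \<Sum>i\<le>n. a i * x ^ i)"
      using g(1) by (auto simp: real_polynomial_function_iff_sum)
    have cg: "continuous_on UNIV g"
      unfolding gs by (intro continuous_intros)
    have err: "\<bar>(\<integral>x. f x \<partial>M) - (\<integral>x. g x \<partial>M)\<bar> \<le> e"
      if M: "real_distribution M" "AE x in M. \<bar>x\<bar> \<le> R" for M
    proof -
      interpret M: real_distribution M by fact
      have d: "integrable M (\<lambda>x. f x - g x)"
        using integrable_continuous_AE_bounded[OF M] f cg by auto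
      have "\<bar>(\<integral>x. f x \<partial>M) - (\<integral>x. g x \<partial>M)\<bar> = \<bar>\<integral>x. f x - g x \<partial>M\<bar>"
        using integrable_continuous_AE_bounded[OF M] f cg by (subst Bochner_Integration.integral_diff) auto
      also have "\<dots> \<le> (\<integral>x. \<bar>f x - g x\<bar> \<partial>M)"
        by (rule integral_abs_bound)
      also have "\<dots> \<le> e"
        using d
      proof (intro M.integral_le_const)
        show "AE x in M. \<bar>f x - g x\<bar> \<le> e"
          using M(2) by eventually_elim (use g(2) in \<open>simp add: abs_le_iff[of _ R] less_imp_le\<close>)
      qed auto
      finally show ?thesis .
    qed
    have gi: "(\<integral>x. g x \<partial>M) = (\<Sum>i\<le>n. a i * (\<integral>x. x ^ i \<partial>M))"
      if M: "real_distribution M" "AE x in M. \<bar>x\<bar> \<le> R" for M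
    proof -
      have "integrable M (\<lambda>x. x ^ i)" for i
        by (intro integrable_continuous_AE_bounded[OF M] continuous_intros)
      then show ?thesis
        unfolding gs by (subst Bochner_Integration.integral_sum) auto
    qed
    show ?thesis
      using err[OF \<nu>] err[OF \<nu>'] gi[OF \<nu>] gi[OF \<nu>'] mom by simp
  qed
  \<comment> \<open>If the difference were \<open>d > 0\<close>, the choice \<open>e = d / 3\<close>
    would give \<open>d \<le> 2 * d / 3\<close>.\<close>
  from this[of "\<bar>(\<integral>x. f x \<partial>\<nu>) - (\<integral>x. f x \<partial>\<nu>')\<bar> / 3"] show ?thesis
    by (cases "(\<integral>x. f x \<partial>\<nu>) = (\<integral>x. f x \<partial>\<nu>')") auto
qed

text \<open>The real and imaginary parts of a characteristic function are integrals of the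
  continuous functions \<open>cos (t * x)\<close> and \<open>sin (t * x)\<close>, hence fixed by the
  moments; Levy's uniqueness theorem does the rest.\<close>

lemma moment_determinacy_bounded:
  assumes \<nu>: "real_distribution \<nu>" "AE x in \<nu>. \<bar>x\<bar> \<le> R"
    and \<nu>': "real_distribution \<nu>'" "AE x in \<nu>'. \<bar>x\<bar> \<le> R"
    and mom: "\<And>k. (\<integral>x. x ^ k \<partial>\<nu>) = (\<integral>x. x ^ k \<partial>\<nu>')"
  shows "\<nu> = \<nu>'"
proof (rule Levy_uniqueness[OF \<nu>(1) \<nu>'(1)], rule ext, rule complex_eqI)
  have char: "char M t = Complex (\<integral>x. cos (t * x) \<partial>M) (\<integral>x. sin (t * x) \<partial>M)"
    if "real_distribution M" for M t
  proof -
    interpret real_distribution M by fact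
    have i: "integrable M (\<lambda>x. iexp (t * x))"
      by (intro integrable_iexp) auto
    show ?thesis
      unfolding char_def using integral_Re[OF i] integral_Im[OF i] by (simp add: complex_eq_iff Re_exp Im_exp)
  qed
  fix t
  show "Re (char \<nu> t) = Re (char \<nu>' t)" "Im (char \<nu> t) = Im (char \<nu>' t)"
    unfolding char[OF \<nu>(1)] char[OF \<nu>'(1)] complex.sel
    by (auto intro!: integral_eq_if_moments_eq[OF assms] continuous_intros)
qed

text \<open>For \<open>r > R\<close>, Markov's inequality at order \<open>2 * k\<close> bounds the
  mass of \<open>r \<le> \<bar>x\<bar>\<close> by \<open>(R / r) ^ (2 * k)\<close>, which tends to 0
  as \<open>k\<close> grows. Countably many \<open>r\<close> decreasing to \<open>R\<close> then
  suffice.\<close>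

lemma AE_abs_le_if_even_moments_le:
  assumes \<nu>: "real_distribution \<nu>" and R: "0 \<le> R"
    and int: "\<And>k. integrable \<nu> (\<lambda>x. x ^ (2 * k))"
    and mom: "\<And>k. (\<integral>x. x ^ (2 * k) \<partial>\<nu>) \<le> R ^ (2 * k)"
  shows "AE x in \<nu>. \<bar>x\<bar> \<le> R"
proof -
  interpret real_distribution \<nu> by fact
  have "AE x in \<nu>. \<bar>x\<bar> < r" if "r > R" for r
  proof -
    have "measure \<nu> {x. r \<le> \<bar>x\<bar>} \<le> ((R / r)\<^sup>2) ^ k" for k
    proof -
      have "{x. r \<le> \<bar>x\<bar>} \<subseteq> {x. r ^ (2 * k) \<le> x ^ (2 * k)}"
        using power_mono[of r "\<bar>_\<bar>" "2 * k"] that R by (auto simp: power_even_abs)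
      then have "measure \<nu> {x. r \<le> \<bar>x\<bar>} \<le> measure \<nu> {x \<in> space \<nu>. r ^ (2 * k) \<le> x ^ (2 * k)}"
        by (intro finite_measure_mono) auto
      also have "\<dots> \<le> (\<integral>x. x ^ (2 * k) \<partial>\<nu>) / r ^ (2 * k)"
        using that R int by (intro integral_Markov_inequality_measure[where A = "{}"]) auto
      also have "\<dots> \<le> R ^ (2 * k) / r ^ (2 * k)"
        using mom that R by (intro divide_right_mono) auto
      finally show ?thesis
        by (simp add: power_mult power_divide)
    qed
    moreover have "(\<lambda>k. ((R / r)\<^sup>2) ^ k) \<longlonglongrightarrow> 0"
      using that R by (intro LIMSEQ_power_zero) (auto simp: power_less_one_iff abs_square_less_1)
    ultimately have "measure \<nu> {x. r \<le> \<bar>x\<bar>} \<le> 0"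
      by (intro LIMSEQ_le_const) auto
    then have "measure \<nu> {x. r \<le> \<bar>x\<bar>} = 0"
      using measure_nonneg by (rule antisym)
    then show ?thesis
      by (intro AE_I[where N = "{x. r \<le> \<bar>x\<bar>}"]) (auto simp: emeasure_eq_measure)
  qed
  then have "AE x in \<nu>. \<forall>n. \<bar>x\<bar> < R + inverse (real (Suc n))"
    by (subst AE_all_countable) auto
  then show ?thesis
  proof eventually_elim
    case (elim x)
    have "(\<lambda>n. R + inverse (real (Suc n))) \<longlonglongrightarrow> R + 0"
      by (intro tendsto_intros LIMSEQ_inverse_real_of_nat)
    then show ?case
      using elim by (intro LIMSEQ_le_const) (auto simp: less_imp_le)
  qed
qed

lemma moments_eq_if_moment_matrix_eq:
  "moment_matrix \<nu> = moment_matrix \<nu>' \<Longrightarrow> (\<integral>x. x ^ k \<partial>\<nu>) = (\<integral>x. x ^ k \<partial>\<nu>')"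
  by (drule fun_cong[of _ _ k], drule fun_cong[of _ _ 0]) (simp add: moment_matrix_def)

text \<open>Makes monomials admissible test functions for the contraction estimate, which works with
  Lipschitz constants on \<open>[-R, R]\<close>.\<close>

lemma power_lipschitz_on_bounded:
  assumes "0 \<le> R"
  shows "\<exists>L. L-lipschitz_on {-R..R} (\<lambda>x::real. x ^ k)"
proof (induction k)
  case 0
  show ?case
    by (auto intro: lipschitz_on_constant)
next
  case (Suc k)
  then obtain L where L: "L-lipschitz_on {-R..R} (\<lambda>x::real. x ^ k)"
    by blast
  have "(R * L + R ^ k)-lipschitz_on {-R..R} (\<lambda>x::real. x ^ Suc k)"
  proof (rule lipschitz_onI)
    fix x y :: real
    assume xy: "x \<in> {-R..R}" "y \<in> {-R..R}"
    have "\<bar>x ^ Suc k - y ^ Suc k\<bar> = \<bar>x * (x ^ k - y ^ k) + y ^ k * (x - y)\<bar>"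
      by (simp add: algebra_simps)
    also have "\<dots> \<le> \<bar>x\<bar> * \<bar>x ^ k - y ^ k\<bar> + \<bar>y\<bar> ^ k * \<bar>x - y\<bar>"
      by (rule order_trans[OF abs_triangle_ineq]) (simp add: abs_mult power_abs)
    also have "\<dots> \<le> R * (L * \<bar>x - y\<bar>) + R ^ k * \<bar>x - y\<bar>"
      using xy assms lipschitz_onD[OF L xy]
      by (intro add_mono mult_mono power_mono) (auto simp: dist_real_def)
    finally show "dist (x ^ Suc k) (y ^ Suc k) \<le> (R * L + R ^ k) * dist x y"
      by (simp add: dist_real_def algebra_simps)
  next
    show "0 \<le> R * L + R ^ k"
      using assms lipschitz_on_nonneg[OF L] by simp
  qed
  then show ?case
    by blast
qed

section \<open>Contraction estimates and fixed points of \<open>S\<close>\<close>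

text \<open>The bound on \<open>\<tau> i 0\<close> is scaled by \<open>1 - c\<close> so that
  \<open>c * R + (1 - c) * R = R\<close>: each \<open>\<tau> i\<close> then maps
  \<open>[-R, R]\<close> into itself.\<close>

locale contractive_real_ifs =
  fixes I :: "'i set" and p :: "'i \<Rightarrow> real" and \<tau> :: "'i \<Rightarrow> real \<Rightarrow> real" and c R :: real
  assumes finite_I: "finite I"
    and p_nonneg: "i \<in> I \<Longrightarrow> 0 \<le> p i"
    and sum_p: "(\<Sum>i\<in>I. p i) = 1"
    and c_less_1: "c < 1"
    and lipschitz: "i \<in> I \<Longrightarrow> c-lipschitz_on UNIV (\<tau> i)"
    and bound_0: "i \<in> I \<Longrightarrow> \<bar>\<tau> i 0\<bar> \<le> (1 - c) * R"
begin

abbreviation "S \<equiv> hutchinson_op I p \<tau>"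

lemma I_nonempty: "I \<noteq> {}"
  using sum_p by auto

lemma c_nonneg: "0 \<le> c"
  using I_nonempty lipschitz lipschitz_on_nonneg by blast

lemma R_nonneg: "0 \<le> R"
proof -
  obtain i where "i \<in> I"
    using I_nonempty by blast
  then have "0 \<le> (1 - c) * R"
    using bound_0 abs_ge_zero order_trans by blast
  then show ?thesis
    using c_less_1 by (simp add: zero_le_mult_iff)
qed

lemma abs_diff_le: "i \<in> I \<Longrightarrow> \<bar>\<tau> i x - \<tau> i y\<bar> \<le> c * \<bar>x - y\<bar>"
  using lipschitz_onD[OF lipschitz, of i x y] by (simp add: dist_real_def)

lemma continuous_\<tau>: "i \<in> I \<Longrightarrow> continuous_on A (\<tau> i)"
  using lipschitz_on_continuous_on[OF lipschitz] continuous_on_subset by blast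

lemma measurable_\<tau> [measurable (raw)]: "i \<in> I \<Longrightarrow> \<tau> i \<in> borel_measurable borel"
  by (intro borel_measurable_continuous_onI continuous_\<tau>)

lemma abs_\<tau>_le: "i \<in> I \<Longrightarrow> \<bar>\<tau> i x\<bar> \<le> c * \<bar>x\<bar> + (1 - c) * R"
  using abs_diff_le[of i x 0] bound_0[of i] by auto

lemma abs_\<tau>_le_R:
  assumes "i \<in> I" "\<bar>x\<bar> \<le> R"
  shows "\<bar>\<tau> i x\<bar> \<le> R"
proof -
  have "\<bar>\<tau> i x\<bar> \<le> c * R + (1 - c) * R"
    using abs_\<tau>_le[OF assms(1), of x] mult_left_mono[OF assms(2) c_nonneg] by linarith
  then show ?thesis
    by (simp add: algebra_simps)
qed

text \<open>Convexity of \<open>t ^ (2 * k)\<close> keeps the constant \<open>c\<close>, so that this bound can be integrated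
  and solved for the moment of order \<open>2 * k\<close> without Minkowski's inequality.\<close>

lemma \<tau>_even_power_le:
  assumes "i \<in> I"
  shows "\<tau> i x ^ (2 * k) \<le> c * x ^ (2 * k) + (1 - c) * R ^ (2 * k)"
proof -
  have "\<tau> i x ^ (2 * k) = \<bar>\<tau> i x\<bar> ^ (2 * k)"
    by (simp add: power_even_abs)
  also have "\<dots> \<le> (c *\<^sub>R \<bar>x\<bar> + (1 - c) *\<^sub>R R) ^ (2 * k)"
    using abs_\<tau>_le[OF assms] by (intro power_mono) auto
  also have "\<dots> \<le> c * \<bar>x\<bar> ^ (2 * k) + (1 - c) * R ^ (2 * k)"
    using convex_onD[OF convex_power_even[of "2 * k"], of "1 - c" "\<bar>x\<bar>" R] c_nonneg c_less_1 by simp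
  finally show ?thesis
    by (simp add: power_even_abs)
qed

lemma sum_p_mult: "(\<Sum>i\<in>I. p i * a) = a"
  by (simp add: sum_distrib_right[symmetric] sum_p)

lemma real_distribution_S:
  assumes "real_distribution \<nu>"
  shows "real_distribution (S \<nu>)"
proof -
  interpret real_distribution \<nu> by fact
  have "(\<Sum>i\<in>I. ennreal (p i)) = 1"
    using p_nonneg sum_p by (simp add: sum_ennreal)
  moreover have "emeasure (distr \<nu> borel (\<tau> i)) UNIV = 1" if "i \<in> I" for i
    using that emeasure_space_1 by (subst emeasure_distr) auto
  ultimately have "emeasure (S \<nu>) UNIV = 1"
    by (simp add: emeasure_hutchinson_op)
  then show ?thesis
    by (intro real_distribution.intro real_distribution_axioms.intro prob_spaceI)
       (simp_all add: sets_eq_imp_space_eq[OF sets_hutchinson_op])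
qed

lemma AE_abs_le_S:
  assumes "sets \<nu> = sets borel" "AE x in \<nu>. \<bar>x\<bar> \<le> R"
  shows "AE x in S \<nu>. \<bar>x\<bar> \<le> R"
proof (rule AE_hutchinson_op)
  fix i assume "i \<in> I"
  with assms(2) show "AE x in \<nu>. \<bar>\<tau> i x\<bar> \<le> R"
    by (auto intro: abs_\<tau>_le_R elim: AE_mp)
qed (use assms(1) measurable_\<tau> in auto)

lemma iterate_S:
  assumes "real_distribution \<nu>" "AE x in \<nu>. \<bar>x\<bar> \<le> R"
  shows "real_distribution ((S ^^ n) \<nu>)" "AE x in (S ^^ n) \<nu>. \<bar>x\<bar> \<le> R"
proof (induction n)
  case 0
  {
    case 1
    then show ?case using assms by simp
  next
    case 2
    then show ?case using assms unfolding funpow.simps id_apply by simp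
  }
next
  case (Suc n)
  {
    case 1
    then show ?case by (simp add: real_distribution_S Suc)
  next
    case 2
    show ?case
      unfolding funpow.simps o_apply
      by (rule AE_abs_le_S[OF real_distribution.events_eq_borel]) (rule Suc)+
  }
qed

lemma integral_iterate_S_diff_le:
  assumes \<nu>: "real_distribution \<nu>" "AE x in \<nu>. \<bar>x\<bar> \<le> R"
    and \<nu>': "real_distribution \<nu>'" "AE x in \<nu>'. \<bar>x\<bar> \<le> R"
    and f: "continuous_on UNIV f" "L-lipschitz_on {-R..R} f"
  shows "\<bar>(\<integral>x. f x \<partial>(S ^^ n) \<nu>) - (\<integral>x. f x \<partial>(S ^^ n) \<nu>')\<bar> \<le> c ^ n * (2 * (L * R))"
  using f
\<comment> \<open>The test function varies because one application of \<open>S\<close> trades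
  \<open>f\<close> for an average \<open>g\<close> with constant \<open>c * L\<close>.\<close>
proof (induction n arbitrary: f L)
  case 0
  \<comment> \<open>Both integrals lie within \<open>L * R\<close> of the common value
    \<open>f 0\<close>, which is the origin of the factor 2.\<close>
  have *: "\<bar>(\<integral>x. f x \<partial>M) - f 0\<bar> \<le> L * R" if M: "real_distribution M" "AE x in M. \<bar>x\<bar> \<le> R" for M
  proof -
    interpret M: real_distribution M by fact
    have int: "integrable M f"
      by (rule integrable_continuous_AE_bounded[OF M 0(1)])
    have "(\<integral>x. f x \<partial>M) - f 0 = (\<integral>x. f x - f 0 \<partial>M)"
      using int by (simp add: M.prob_space del: M.space_eq_univ)
    also have "\<bar>\<dots>\<bar> \<le> (\<integral>x. \<bar>f x - f 0\<bar> \<partial>M)"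
      by (rule integral_abs_bound)
    also have "\<dots> \<le> L * R"
    proof (rule M.integral_le_const)
      show "AE x in M. \<bar>f x - f 0\<bar> \<le> L * R"
        using M(2)
      proof eventually_elim
        case (elim x)
        then have x: "x \<in> {-R..R}"
          by (simp add: abs_le_iff minus_le_iff)
        have "\<bar>f x - f 0\<bar> \<le> L * \<bar>x\<bar>"
          using lipschitz_onD[OF 0(2) x, of 0] R_nonneg by (simp add: dist_real_def)
        also have "\<dots> \<le> L * R"
          using elim lipschitz_on_nonneg[OF 0(2)] by (rule mult_left_mono)
        finally show ?case .
      qed
    qed (use int in auto)
    finally show ?thesis .
  qed
  show ?case
    using *[OF \<nu>] *[OF \<nu>'] by simp
next
  case (Suc n)
  define g where "g x = (\<Sum>i\<in>I. p i * f (\<tau> i x))" for x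
  have fm [measurable]: "f \<in> borel_measurable borel"
    using Suc.prems(1) by (rule borel_measurable_continuous_onI)
  have cont: "continuous_on UNIV (\<lambda>x. f (\<tau> i x))" if "i \<in> I" for i
    using continuous_on_compose2[OF Suc.prems(1) continuous_\<tau>[OF that]] by auto
  \<comment> \<open>Only the outermost \<open>S\<close> is moved onto the test function; the
    remaining \<open>n\<close> iterates are left to the induction hypothesis for
    \<open>g\<close>.\<close>
  have eq: "(\<integral>x. f x \<partial>(S ^^ Suc n) M) = (\<integral>x. g x \<partial>(S ^^ n) M)"
    if M: "real_distribution M" "AE x in M. \<bar>x\<bar> \<le> R" for M
  proof -
    interpret M: real_distribution "(S ^^ n) M"
      by (rule iterate_S[OF M])
    have int: "integrable ((S ^^ n) M) (\<lambda>x. f (\<tau> i x))" if "i \<in> I" for i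
      using integrable_continuous_AE_bounded[OF iterate_S[OF M] cont[OF that]] .
    show ?thesis
      unfolding g_def using int p_nonneg
      by (simp add: integral_hutchinson_op)
  qed
  have "(c * L)-lipschitz_on {-R..R} g"
  proof (rule lipschitz_onI)
    fix x y assume xy: "x \<in> {-R..R}" "y \<in> {-R..R}"
    have "\<bar>g x - g y\<bar> \<le> (\<Sum>i\<in>I. \<bar>p i * f (\<tau> i x) - p i * f (\<tau> i y)\<bar>)"
      unfolding g_def sum_subtractf[symmetric] by (rule sum_abs)
    also have "\<dots> \<le> (\<Sum>i\<in>I. p i * (c * L * \<bar>x - y\<bar>))"
    proof (rule sum_mono)
      fix i assume i: "i \<in> I"
      \<comment> \<open>\<open>f\<close> is Lipschitz on \<open>[-R, R]\<close> only, so the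
        invariance of this interval under \<open>\<tau> i\<close> is used here.\<close>
      have "\<bar>f (\<tau> i x) - f (\<tau> i y)\<bar> \<le> L * \<bar>\<tau> i x - \<tau> i y\<bar>"
        using lipschitz_onD[OF Suc.prems(2), of "\<tau> i x" "\<tau> i y"] abs_\<tau>_le_R[OF i, of x] abs_\<tau>_le_R[OF i, of y] xy
        by (auto simp: dist_real_def abs_le_iff)
      also have "\<dots> \<le> L * (c * \<bar>x - y\<bar>)"
        by (intro mult_left_mono abs_diff_le i lipschitz_on_nonneg[OF Suc.prems(2)])
      finally have "\<bar>f (\<tau> i x) - f (\<tau> i y)\<bar> \<le> c * L * \<bar>x - y\<bar>"
        by (simp add: mult_ac)
      then show "\<bar>p i * f (\<tau> i x) - p i * f (\<tau> i y)\<bar> \<le> p i * (c * L * \<bar>x - y\<bar>)"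
        using p_nonneg[OF i] by (simp add: right_diff_distrib[symmetric] abs_mult mult_left_mono)
    qed
    finally show "dist (g x) (g y) \<le> c * L * dist x y"
      by (simp add: dist_real_def sum_p_mult)
  qed (use c_nonneg lipschitz_on_nonneg[OF Suc.prems(2)] in simp)
  moreover have "continuous_on UNIV g"
    unfolding g_def by (intro continuous_intros cont)
  ultimately have "\<bar>(\<integral>x. g x \<partial>(S ^^ n) \<nu>) - (\<integral>x. g x \<partial>(S ^^ n) \<nu>')\<bar> \<le> c ^ n * (2 * (c * L * R))"
    by (intro Suc.IH)
  then show ?case
    unfolding eq[OF \<nu>] eq[OF \<nu>'] by (simp add: mult_ac)
qed

lemma moments_iterate_S_tendsto:
  assumes \<nu>: "real_distribution \<nu>" "AE x in \<nu>. \<bar>x\<bar> \<le> R"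
    and \<mu>: "real_distribution \<mu>" "AE x in \<mu>. \<bar>x\<bar> \<le> R" "S \<mu> = \<mu>"
  shows "(\<lambda>n. \<integral>x. x ^ k \<partial>(S ^^ n) \<nu>) \<longlonglongrightarrow> (\<integral>x. x ^ k \<partial>\<mu>)"
proof -
  obtain L where L: "L-lipschitz_on {-R..R} (\<lambda>x::real. x ^ k)"
    using power_lipschitz_on_bounded[OF R_nonneg] by blast
  have cont: "continuous_on UNIV (\<lambda>x::real. x ^ k)"
    by (intro continuous_intros)
  have fixed: "(S ^^ n) \<mu> = \<mu>" for n
    by (induction n) (use \<mu>(3) in auto)
  have "\<bar>(\<integral>x. x ^ k \<partial>(S ^^ n) \<nu>) - (\<integral>x. x ^ k \<partial>\<mu>)\<bar> \<le> c ^ n * (2 * (L * R))" for n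
    using integral_iterate_S_diff_le[OF \<nu> \<mu>(1,2) cont L, of n] unfolding fixed .
  then have bound: "norm ((\<integral>x. x ^ k \<partial>(S ^^ n) \<nu>) - (\<integral>x. x ^ k \<partial>\<mu>)) \<le> c ^ n * (2 * (L * R))" for n
    by simp
  have "(\<lambda>n. c ^ n * (2 * (L * R))) \<longlonglongrightarrow> 0"
    using c_nonneg c_less_1 by (intro tendsto_mult_left_zero LIMSEQ_power_zero) simp
  with always_eventually[OF allI[OF bound]] show ?thesis
    by (rule LIM_zero_cancel[OF Lim_null_comparison])
qed

text \<open>The moments of the iterates of \<open>\<nu>\<close> are constant and converge to those
  of \<open>\<mu>\<close>, so the two measures have equal moments and determinacy applies.\<close>

lemma S_fixed_point_unique:
  assumes "real_distribution \<nu>" "AE x in \<nu>. \<bar>x\<bar> \<le> R" "S \<nu> = \<nu>"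
    and \<mu>: "real_distribution \<mu>" "AE x in \<mu>. \<bar>x\<bar> \<le> R" "S \<mu> = \<mu>"
  shows "\<nu> = \<mu>"
proof (rule moment_determinacy_bounded[OF assms(1,2) \<mu>(1,2)])
  fix k
  have "(S ^^ n) \<nu> = \<nu>" for n
    by (induction n) (use assms(3) in auto)
  then show "(\<integral>x. x ^ k \<partial>\<nu>) = (\<integral>x. x ^ k \<partial>\<mu>)"
    using moments_iterate_S_tendsto[OF assms(1,2) \<mu>, of k] by (simp add: LIMSEQ_const_iff)
qed

text \<open>Reduces uniqueness among all probability measures with finite moments to measures on
  \<open>[-R, R]\<close>, where moments determine the measure.\<close>

lemma AE_abs_le_if_moments_S_eq:
  assumes \<nu>: "real_distribution \<nu>" and int: "\<And>k. integrable \<nu> (\<lambda>x. x ^ k)"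
    and mom: "\<And>k. (\<integral>x. x ^ k \<partial>S \<nu>) = (\<integral>x. x ^ k \<partial>\<nu>)"
  shows "AE x in \<nu>. \<bar>x\<bar> \<le> R"
proof (rule AE_abs_le_if_even_moments_le[OF \<nu> R_nonneg int])
  interpret real_distribution \<nu> by fact
  fix k
  let ?m = "\<integral>x. x ^ (2 * k) \<partial>\<nu>"
  have i1: "integrable \<nu> (\<lambda>x. c * x ^ (2 * k) + (1 - c) * R ^ (2 * k))"
    using int by simp
  have i2: "integrable \<nu> (\<lambda>x. \<tau> i x ^ (2 * k))" if [simp]: "i \<in> I" for i
    by (rule Bochner_Integration.integrable_bound[OF i1])
       (use \<tau>_even_power_le[OF that] in \<open>auto intro: order_trans[OF _ abs_ge_self]\<close>)
  have "?m = (\<Sum>i\<in>I. p i * (\<integral>x. \<tau> i x ^ (2 * k) \<partial>\<nu>))"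
    unfolding mom[symmetric] by (rule integral_hutchinson_op) (use i2 p_nonneg in auto)
  also have "\<dots> \<le> (\<Sum>i\<in>I. p i * (\<integral>x. c * x ^ (2 * k) + (1 - c) * R ^ (2 * k) \<partial>\<nu>))"
    by (intro sum_mono mult_left_mono integral_mono i1 i2 \<tau>_even_power_le p_nonneg)
  also have "\<dots> = c * ?m + (1 - c) * R ^ (2 * k)"
    using int by (simp add: sum_p_mult prob_space del: space_eq_univ)
  \<comment> \<open>\<open>?m\<close> occurs on both sides; since \<open>c < 1\<close>, the term
    \<open>c * ?m\<close> can be absorbed on the left.\<close>
  finally have "(1 - c) * ?m \<le> (1 - c) * R ^ (2 * k)"
    by (simp add: algebra_simps)
  then show "?m \<le> R ^ (2 * k)"
    using c_less_1 by simp
qed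

section \<open>The coding map and the attractor\<close>

text \<open>Symbols outside \<open>I\<close> are read as one fixed symbol of \<open>I\<close>, so that streams over the whole
  type code points and no restriction to \<open>streams I\<close> is needed.\<close>

definition step :: "'i \<Rightarrow> real \<Rightarrow> real" where
  "step i = \<tau> (if i \<in> I then i else (SOME j. j \<in> I))"

text \<open>The first symbol gives the outermost map, so later symbols act through more contractions
  and the values converge.\<close>

primrec approx :: "nat \<Rightarrow> 'i stream \<Rightarrow> real" where
  "approx 0 = (\<lambda>\<omega>. 0)"
| "approx (Suc n) = (\<lambda>\<omega>. step (shd \<omega>) (approx n (stl \<omega>)))"

definition coding :: "'i stream \<Rightarrow> real" where
  "coding \<omega> = lim (\<lambda>n. approx n \<omega>)"

lemma step_eq: "\<exists>j\<in>I. step i = \<tau> j"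
  unfolding step_def using I_nonempty some_in_eq by auto

lemma continuous_step: "continuous_on A (step i)"
  using step_eq[of i] continuous_\<tau> by auto

lemma approx_le: "\<bar>approx n \<omega>\<bar> \<le> R"
proof (induction n arbitrary: \<omega>)
  case 0
  show ?case using R_nonneg by simp
next
  case (Suc n)
  show ?case
    using step_eq[of "shd \<omega>"] abs_\<tau>_le_R[OF _ Suc] by auto
qed

text \<open>The \<open>n\<close> outer maps are shared, each contributing a factor \<open>c\<close>.
  Beneath them a point of \<open>[-R, R]\<close> is compared with 0, at distance at most
  \<open>R\<close>.\<close>

lemma approx_diff_le: "\<bar>approx (n + k) \<omega> - approx n \<omega>\<bar> \<le> c ^ n * R"
proof (induction n arbitrary: \<omega>)
  case 0
  show ?case using approx_le by simp
next
  case (Suc n)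
  obtain j where j: "j \<in> I" "step (shd \<omega>) = \<tau> j"
    using step_eq by blast
  have "\<bar>approx (Suc n + k) \<omega> - approx (Suc n) \<omega>\<bar> \<le> c * \<bar>approx (n + k) (stl \<omega>) - approx n (stl \<omega>)\<bar>"
    using abs_diff_le[OF j(1)] j(2) by simp
  also have "\<dots> \<le> c * (c ^ n * R)"
    by (intro mult_left_mono Suc c_nonneg)
  finally show ?case by (simp add: mult_ac)
qed

lemma approx_tendsto: "(\<lambda>n. approx n \<omega>) \<longlonglongrightarrow> coding \<omega>"
proof -
  have "Cauchy (\<lambda>n. approx n \<omega>)"
  proof (rule CauchyI')
    fix e :: real
    assume "0 < e"
    have "(\<lambda>n. c ^ n * R) \<longlonglongrightarrow> 0"
      using c_nonneg c_less_1 by (intro tendsto_mult_left_zero LIMSEQ_power_zero) simp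
    from order_tendstoD(2)[OF this \<open>0 < e\<close>] obtain N where N: "c ^ n * R < e" if "n \<ge> N" for n
      by (auto simp: eventually_sequentially)
    have "dist (approx m \<omega>) (approx n \<omega>) < e" if "m \<ge> N" "m < n" for m n
      using approx_diff_le[of m "n - m" \<omega>] N[OF that(1)] that(2) by (simp add: dist_real_def abs_minus_commute)
    then show "\<exists>M. \<forall>m\<ge>M. \<forall>n>m. dist (approx m \<omega>) (approx n \<omega>) < e"
      by blast
  qed
  then show ?thesis
    unfolding coding_def by (simp add: Cauchy_convergent convergent_LIMSEQ_iff[symmetric])
qed

lemma coding_le: "\<bar>coding \<omega>\<bar> \<le> R"
  by (rule LIMSEQ_le_const2[OF tendsto_rabs[OF approx_tendsto]]) (use approx_le in auto)

lemma coding_Stream: "coding (i ## \<omega>) = step i (coding \<omega>)"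
proof (rule LIMSEQ_unique)
  show "(\<lambda>n. approx (Suc n) (i ## \<omega>)) \<longlonglongrightarrow> coding (i ## \<omega>)"
    by (rule LIMSEQ_Suc[OF approx_tendsto])
  show "(\<lambda>n. approx (Suc n) (i ## \<omega>)) \<longlonglongrightarrow> step i (coding \<omega>)"
    using continuous_on_tendsto_compose[OF continuous_step[of UNIV] approx_tendsto] by simp
qed

lemma range_coding: "range coding = (\<Union>i\<in>I. \<tau> i ` range coding)"
proof (intro antisym subsetI)
  fix x assume "x \<in> range coding"
  then obtain \<omega> where x: "x = coding \<omega>"
    by blast
  obtain j where j: "j \<in> I" "step (shd \<omega>) = \<tau> j"
    using step_eq by blast
  have "x = \<tau> j (coding (stl \<omega>))"
    using coding_Stream[of "shd \<omega>" "stl \<omega>"] x j by simp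
  with j show "x \<in> (\<Union>i\<in>I. \<tau> i ` range coding)"
    by blast
next
  fix x assume "x \<in> (\<Union>i\<in>I. \<tau> i ` range coding)"
  then obtain i \<omega> where "i \<in> I" "x = \<tau> i (coding \<omega>)"
    by blast
  then have "x = coding (i ## \<omega>)"
    by (simp add: coding_Stream step_def)
  then show "x \<in> range coding"
    by blast
qed

text \<open>Take \<open>x\<close> in \<open>X\<close> farthest from \<open>Y\<close> and write it as
  \<open>\<tau> i x'\<close> with \<open>x'\<close> in \<open>X\<close>. Contraction makes the
  distance of \<open>x\<close> to \<open>Y\<close> at most \<open>c\<close> times that of
  \<open>x'\<close>, hence at most \<open>c\<close> times itself, so it is 0. Used in both
  directions, this gives uniqueness of the attractor.\<close>

lemma attractor_subset_attractor:
  assumes X: "is_attractor I \<tau> X" and Y: "is_attractor I \<tau> Y"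
  shows "X \<subseteq> Y"
proof -
  have X': "compact X" "X \<noteq> {}" "X = (\<Union>i\<in>I. \<tau> i ` X)" and Y': "compact Y" "Y \<noteq> {}" "Y = (\<Union>i\<in>I. \<tau> i ` Y)"
    using X Y by (simp_all add: is_attractor_def)
  obtain x where x: "x \<in> X" "\<And>y. y \<in> X \<Longrightarrow> infdist y Y \<le> infdist x Y"
    using continuous_attains_sup[OF X'(1,2) continuous_on_infdist[OF continuous_on_id]] by blast
  obtain i x' where i: "i \<in> I" "x' \<in> X" "x = \<tau> i x'"
    using x(1) X'(3) by blast
  obtain y where y: "y \<in> Y" "infdist x' Y = dist x' y"
    using infdist_attains_inf[OF compact_imp_closed[OF Y'(1)] Y'(2)] by blast
  have "\<tau> i y \<in> Y"
    using i(1) y(1) Y'(3) by blast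
  then have "infdist x Y \<le> dist x (\<tau> i y)"
    by (rule infdist_le)
  also have "\<dots> \<le> c * infdist x' Y"
    unfolding y(2) i(3) by (rule lipschitz_onD[OF lipschitz]) (use i(1) in auto)
  also have "\<dots> \<le> c * infdist x Y"
    by (intro mult_left_mono x(2) i(2) c_nonneg)
  finally have "(1 - c) * infdist x Y \<le> 0"
    by (simp add: algebra_simps)
  then have *: "infdist x Y \<le> 0"
    using c_less_1 by (simp add: mult_le_0_iff)
  show "X \<subseteq> Y"
  proof
    fix z assume "z \<in> X"
    then have "infdist z Y = 0"
      using x(2)[of z] * infdist_nonneg[of z Y] by linarith
    then show "z \<in> Y"
      using in_closed_iff_infdist_zero[OF compact_imp_closed[OF Y'(1)] Y'(2)] by blast
  qed
qed

text \<open>The range of \<open>coding\<close> is bounded and self-similar; passing to its closure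
  yields compactness without a topology on streams. Self-similarity survives because a finite union
  of compact images is closed and each \<open>\<tau> i\<close> is continuous.\<close>

lemma is_attractor_closure_range_coding: "is_attractor I \<tau> (closure (range coding))"
proof -
  have bdd: "bounded (range coding)"
    using coding_le by (auto simp: bounded_iff)
  then have cpt: "compact (closure (range coding))"
    by simp
  have "closure (range coding) = (\<Union>i\<in>I. \<tau> i ` closure (range coding))"
  proof (rule antisym)
    have "compact (\<Union>i\<in>I. \<tau> i ` closure (range coding))"
      using finite_I cpt by (intro compact_UN compact_continuous_image continuous_\<tau>)
    moreover have "range coding \<subseteq> (\<Union>i\<in>I. \<tau> i ` closure (range coding))"
      by (subst range_coding) (intro UN_mono image_mono closure_subset subset_refl)
    ultimately show "closure (range coding) \<subseteq> (\<Union>i\<in>I. \<tau> i ` closure (range coding))"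
      by (intro closure_minimal compact_imp_closed)
    have "\<tau> i ` range coding \<subseteq> closure (range coding)" if "i \<in> I" for i
      using that range_coding closure_subset[of "range coding"] by blast
    then show "(\<Union>i\<in>I. \<tau> i ` closure (range coding)) \<subseteq> closure (range coding)"
      by (intro UN_least image_closure_subset continuous_\<tau> closed_closure)
  qed
  then show ?thesis
    unfolding is_attractor_def using cpt by auto
qed

lemma attractor_eq: "attractor I \<tau> = closure (range coding)"
  unfolding attractor_def
  by (rule the_equality)
     (use is_attractor_closure_range_coding attractor_subset_attractor in blast)+

lemma attractor_subset: "attractor I \<tau> \<subseteq> {-R..R}"
  unfolding attractor_eq using coding_le
  by (intro closure_minimal) (auto simp: abs_le_iff minus_le_iff)

lemma AE_abs_le_if_supported:
  assumes "real_distribution \<nu>" "emeasure \<nu> (- attractor I \<tau>) = 0"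
  shows "AE x in \<nu>. \<bar>x\<bar> \<le> R"
proof (rule AE_I)
  interpret real_distribution \<nu> by fact
  show "- attractor I \<tau> \<in> sets \<nu>"
    unfolding attractor_eq by (simp add: borel_closed)
  show "{x \<in> space \<nu>. \<not> \<bar>x\<bar> \<le> R} \<subseteq> - attractor I \<tau>"
    using attractor_subset by (auto simp: abs_le_iff)
qed fact

section \<open>The invariant measure on the attractor\<close>

definition symbol_pmf :: "'i pmf" where
  "symbol_pmf = embed_pmf (\<lambda>i. if i \<in> I then p i else 0)"

definition coding_measure :: "real measure" where
  "coding_measure = distr (stream_space (measure_pmf symbol_pmf)) borel coding"

lemma pmf_symbol_pmf: "pmf symbol_pmf i = (if i \<in> I then p i else 0)"
  unfolding symbol_pmf_def
proof (rule pmf_embed_pmf)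
  have "(\<integral>\<^sup>+i. ennreal (if i \<in> I then p i else 0) \<partial>count_space UNIV)
      = (\<Sum>i\<in>I. ennreal (if i \<in> I then p i else 0))"
    using finite_I by (intro nn_integral_count_space') auto
  also have "\<dots> = 1"
    using p_nonneg sum_p by (simp add: sum_ennreal)
  finally show "(\<integral>\<^sup>+i. ennreal (if i \<in> I then p i else 0) \<partial>count_space UNIV) = 1" .
qed (use p_nonneg in auto)

lemma measurable_step_shd:
  assumes [measurable]: "f \<in> borel_measurable (stream_space (measure_pmf symbol_pmf))"
  shows "(\<lambda>\<omega>. step (shd \<omega>) (f \<omega>)) \<in> borel_measurable (stream_space (measure_pmf symbol_pmf))"
proof -
  let ?j = "SOME j. j \<in> I"
  have j: "?j \<in> I"
    using I_nonempty some_in_eq by auto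
  \<comment> \<open>The symbol type may be uncountable, so measurability jointly in symbol and point
    is not automatic. A finite case distinction over \<open>I\<close> reduces it to measurability of
    each single \<open>\<tau> i\<close>.\<close>
  have "step (shd \<omega>) (f \<omega>)
      = (if shd \<omega> \<in> I then \<Sum>i\<in>I. if shd \<omega> = i then \<tau> i (f \<omega>) else 0 else \<tau> ?j (f \<omega>))" for \<omega>
    using finite_I by (simp add: step_def sum.delta')
  moreover have "{\<omega> \<in> space (stream_space (measure_pmf symbol_pmf)). Q (shd \<omega>)}
      \<in> sets (stream_space (measure_pmf symbol_pmf))" for Q
    by (rule predE, rule measurable_compose[OF measurable_shd]) simp
  ultimately show ?thesis
    by (simp only:)
       (intro measurable_If borel_measurable_sum measurable_const measurable_compose[OF assms measurable_\<tau>] j, simp_all)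
qed

lemma measurable_coding [measurable]:
  "coding \<in> borel_measurable (stream_space (measure_pmf symbol_pmf))"
proof (rule borel_measurable_LIMSEQ_real)
  show "approx n \<in> borel_measurable (stream_space (measure_pmf symbol_pmf))" for n
  proof (induction n)
    case (Suc n)
    show ?case
      using measurable_step_shd[OF measurable_compose[OF measurable_stl Suc]] by simp
  qed simp
qed (rule approx_tendsto)

lemma real_distribution_coding_measure: "real_distribution coding_measure"
proof -
  interpret prob_space "stream_space (measure_pmf symbol_pmf)"
    by (rule prob_space.prob_space_stream_space[OF prob_space_measure_pmf])
  show ?thesis
    unfolding coding_measure_def by (rule real_distribution_distr) measurable
qed

lemma emeasure_coding_measure_attractor: "emeasure coding_measure (- attractor I \<tau>) = 0"
proof -
  have "coding \<omega> \<in> attractor I \<tau>" for \<omega>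
    using closure_subset[of "range coding"] attractor_eq by auto
  then have "coding -` (- attractor I \<tau>) = {}"
    by auto
  moreover have "- attractor I \<tau> \<in> sets borel"
    unfolding attractor_eq by (simp add: borel_closed)
  ultimately show ?thesis
    unfolding coding_measure_def by (simp add: emeasure_distr)
qed

lemmas AE_coding_measure =
  AE_abs_le_if_supported[OF real_distribution_coding_measure emeasure_coding_measure_attractor]

text \<open>Split off the first symbol of the random stream: it is \<open>i\<close> with probability
  \<open>p i\<close>, the tail has the original law, and \<open>coding (i ## \<omega>)\<close> is
  \<open>\<tau> i (coding \<omega>)\<close>.\<close>

lemma S_coding_measure: "S coding_measure = coding_measure"
proof (rule measure_eqI)
  show "sets (S coding_measure) = sets coding_measure"
    by (simp add: coding_measure_def)
  fix A assume "A \<in> sets (S coding_measure)"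
  then have [measurable]: "A \<in> sets borel"
    by simp
  let ?M = "stream_space (measure_pmf symbol_pmf)"
  have "emeasure coding_measure A = (\<integral>\<^sup>+\<omega>. indicator A (coding \<omega>) \<partial>?M)"
    unfolding coding_measure_def by (subst nn_integral_distr[OF measurable_coding, symmetric]) simp_all
  also have "\<dots> = (\<integral>\<^sup>+i. (\<integral>\<^sup>+\<omega>. indicator A (coding (i ## \<omega>)) \<partial>?M) \<partial>measure_pmf symbol_pmf)"
    by (rule prob_space.nn_integral_stream_space[OF prob_space_measure_pmf]) measurable
  also have "\<dots> = (\<Sum>i\<in>I. (\<integral>\<^sup>+\<omega>. indicator A (coding (i ## \<omega>)) \<partial>?M) * ennreal (pmf symbol_pmf i))"
    using finite_I by (intro nn_integral_measure_pmf_support) (auto simp: set_pmf_iff pmf_symbol_pmf)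
  also have "\<dots> = (\<Sum>i\<in>I. ennreal (p i) * emeasure (distr coding_measure borel (\<tau> i)) A)"
  proof (intro sum.cong refl)
    fix i assume i: "i \<in> I"
    have [measurable]: "\<tau> i \<in> borel_measurable borel"
      using i by (rule measurable_\<tau>)
    have "distr coding_measure borel (\<tau> i) = distr ?M borel (\<lambda>\<omega>. \<tau> i (coding \<omega>))"
      unfolding coding_measure_def by (subst distr_distr) (simp_all add: comp_def)
    then have "emeasure (distr coding_measure borel (\<tau> i)) A
        = (\<integral>\<^sup>+x. indicator A x \<partial>distr ?M borel (\<lambda>\<omega>. \<tau> i (coding \<omega>)))"
      by simp
    also have "\<dots> = (\<integral>\<^sup>+\<omega>. indicator A (\<tau> i (coding \<omega>)) \<partial>?M)"
      by (rule nn_integral_distr) measurable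
    finally show "(\<integral>\<^sup>+\<omega>. indicator A (coding (i ## \<omega>)) \<partial>?M) * ennreal (pmf symbol_pmf i)
        = ennreal (p i) * emeasure (distr coding_measure borel (\<tau> i)) A"
      using i by (simp add: coding_Stream step_def pmf_symbol_pmf mult.commute)
  qed
  also have "\<dots> = emeasure (S coding_measure) A"
    by (simp add: emeasure_hutchinson_op)
  finally show "emeasure (S coding_measure) A = emeasure coding_measure A"
    by simp
qed

lemma hutchinson_measure_eq: "hutchinson_measure I p \<tau> = coding_measure"
  unfolding hutchinson_measure_def
proof (rule the_equality)
  show "is_hutchinson_measure I p \<tau> coding_measure"
    by (simp add: is_hutchinson_measure_def borel_prob_iff real_distribution_coding_measure
        emeasure_coding_measure_attractor S_coding_measure)
next
  fix \<mu> assume "is_hutchinson_measure I p \<tau> \<mu>"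
  then have \<mu>: "real_distribution \<mu>" "emeasure \<mu> (- attractor I \<tau>) = 0" "S \<mu> = \<mu>"
    by (simp_all add: is_hutchinson_measure_def borel_prob_iff)
  show "\<mu> = coding_measure"
    by (rule S_fixed_point_unique[OF \<mu>(1) AE_abs_le_if_supported[OF \<mu>(1,2)] \<mu>(3)
          real_distribution_coding_measure AE_coding_measure S_coding_measure])
qed

section \<open>The relation \<open>moment_transform\<close> and its fixed points\<close>

text \<open>The support bound passes from \<open>\<nu>\<close> to \<open>\<nu>'\<close> through the
  even moments, which the two measures share; after that determinacy on \<open>[-R, R]\<close>
  applies.\<close>

lemma moment_matrix_inj:
  assumes \<nu>: "real_distribution \<nu>" "AE x in \<nu>. \<bar>x\<bar> \<le> R"
    and \<nu>': "real_distribution \<nu>'" "has_all_moments \<nu>'"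
    and eq: "moment_matrix \<nu>' = moment_matrix \<nu>"
  shows "\<nu>' = \<nu>"
proof (rule moment_determinacy_bounded[OF \<nu>'(1) _ \<nu> moments_eq_if_moment_matrix_eq[OF eq]])
  interpret real_distribution \<nu> by fact
  have "(\<integral>x. x ^ (2 * k) \<partial>\<nu>) \<le> R ^ (2 * k)" for k
  proof (rule integral_le_const)
    show "integrable \<nu> (\<lambda>x. x ^ (2 * k))"
      by (intro integrable_continuous_AE_bounded[OF \<nu>] continuous_intros)
    show "AE x in \<nu>. x ^ (2 * k) \<le> R ^ (2 * k)"
      using \<nu>(2)
    proof eventually_elim
      case (elim x)
      then show ?case
        using power_mono[of "\<bar>x\<bar>" R "2 * k"] by (simp add: power_even_abs)
    qed
  qed
  then have "(\<integral>x. x ^ (2 * k) \<partial>\<nu>') \<le> R ^ (2 * k)" for k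
    by (simp add: moments_eq_if_moment_matrix_eq[OF eq])
  moreover have "integrable \<nu>' (\<lambda>x. x ^ (2 * k))" for k
    using \<nu>'(2) by (simp add: has_all_moments_def)
  ultimately show "AE x in \<nu>'. \<bar>x\<bar> \<le> R"
    by (intro AE_abs_le_if_even_moments_le[OF \<nu>'(1) R_nonneg])
qed

lemma has_all_moments_bounded:
  assumes "real_distribution \<nu>" "AE x in \<nu>. \<bar>x\<bar> \<le> R"
  shows "has_all_moments \<nu>"
  unfolding has_all_moments_def
  by (intro allI integrable_continuous_AE_bounded[OF assms] continuous_intros)

text \<open>By \<open>moment_matrix_inj\<close>, \<open>\<nu>\<close> is the only measure that can
  witness a pair starting at its matrix, so the relation is single-valued there.\<close>

lemma moment_transform_Image:
  assumes \<nu>: "real_distribution \<nu>" "AE x in \<nu>. \<bar>x\<bar> \<le> R"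
  shows "moment_transform I p \<tau> `` {moment_matrix \<nu>} = {moment_matrix (S \<nu>)}"
proof (intro antisym subsetI)
  fix M assume "M \<in> moment_transform I p \<tau> `` {moment_matrix \<nu>}"
  then obtain \<nu>' where \<nu>': "real_distribution \<nu>'" "has_all_moments \<nu>'"
    "moment_matrix \<nu>' = moment_matrix \<nu>" and M: "M = moment_matrix (S \<nu>')"
    unfolding moment_transform_def borel_prob_iff by auto
  show "M \<in> {moment_matrix (S \<nu>)}"
    unfolding M moment_matrix_inj[OF \<nu> \<nu>'] by (rule singletonI)
next
  have "(moment_matrix \<nu>, moment_matrix (S \<nu>)) \<in> moment_transform I p \<tau>"
    unfolding moment_transform_def borel_prob_iff using \<nu>(1) has_all_moments_bounded[OF \<nu>] by blast
  then show "M \<in> moment_transform I p \<tau> `` {moment_matrix \<nu>}" if "M \<in> {moment_matrix (S \<nu>)}" for M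
    using that by blast
qed

lemma moment_transform_relpow_Image:
  assumes \<nu>: "real_distribution \<nu>" "AE x in \<nu>. \<bar>x\<bar> \<le> R"
  shows "(moment_transform I p \<tau> ^^ n) `` {moment_matrix \<nu>} = {moment_matrix ((S ^^ n) \<nu>)}"
proof (induction n)
  case (Suc n)
  then show ?case
    using moment_transform_Image[OF iterate_S[OF \<nu>]] by (simp add: relcomp_Image)
qed simp

text \<open>A fixed matrix only says that \<open>\<nu>\<close> and \<open>S \<nu>\<close> have equal
  moments. The support bound must come first; then determinacy upgrades this to
  \<open>S \<nu> = \<nu>\<close>, and uniqueness of invariant measures finishes.\<close>

lemma moment_transform_fixed_iff:
  "(M, M) \<in> moment_transform I p \<tau> \<longleftrightarrow> M = moment_matrix coding_measure"
proof
  assume "(M, M) \<in> moment_transform I p \<tau>"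
  then obtain \<nu> where \<nu>: "real_distribution \<nu>" "has_all_moments \<nu>"
    and M: "M = moment_matrix \<nu>" "moment_matrix (S \<nu>) = moment_matrix \<nu>"
    by (auto simp: moment_transform_def borel_prob_iff)
  have bdd: "AE x in \<nu>. \<bar>x\<bar> \<le> R"
    using \<nu>(2) by (intro AE_abs_le_if_moments_S_eq[OF \<nu>(1) _ moments_eq_if_moment_matrix_eq[OF M(2)]])
      (simp add: has_all_moments_def)
  have Sbdd: "AE x in S \<nu>. \<bar>x\<bar> \<le> R"
    by (rule AE_abs_le_S[OF real_distribution.events_eq_borel[OF \<nu>(1)] bdd])
  have "S \<nu> = \<nu>"
    by (rule moment_matrix_inj[OF \<nu>(1) bdd real_distribution_S[OF \<nu>(1)]
          has_all_moments_bounded[OF real_distribution_S[OF \<nu>(1)] Sbdd] M(2)])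
  then show "M = moment_matrix coding_measure"
    unfolding M(1) using S_fixed_point_unique[OF \<nu>(1) bdd _ real_distribution_coding_measure
        AE_coding_measure S_coding_measure] by simp
next
  assume "M = moment_matrix coding_measure"
  then show "(M, M) \<in> moment_transform I p \<tau>"
    using moment_transform_Image[OF real_distribution_coding_measure AE_coding_measure] S_coding_measure by auto
qed

end

section \<open>Uniform constants and the final theorem\<close>

lemma contractive_ifs_imp_uniform:
  assumes "contractive_ifs I \<tau>" "I \<noteq> {}"
  obtains c R where "c < 1" "\<And>i. i \<in> I \<Longrightarrow> c-lipschitz_on UNIV (\<tau> i)"
    "\<And>i. i \<in> I \<Longrightarrow> \<bar>\<tau> i 0\<bar> \<le> (1 - c) * R"
proof -
  have I: "finite I"
    using assms(1) by (simp add: contractive_ifs_def)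
  obtain C where C: "C i < 1" "(C i)-lipschitz_on UNIV (\<tau> i)" if "i \<in> I" for i
    using assms(1) unfolding contractive_ifs_def by metis
  define c where "c = Max (C ` I)"
  \<comment> \<open>Chosen so that \<open>(1 - c) * R\<close> is the largest
    \<open>\<bar>\<tau> i 0\<bar>\<close>.\<close>
  define R where "R = Max ((\<lambda>i. \<bar>\<tau> i 0\<bar>) ` I) / (1 - c)"
  have c: "c < 1"
    unfolding c_def using I assms(2) C(1) by simp
  show thesis
  proof
    show "c < 1" by fact
    fix i assume i: "i \<in> I"
    have "C i \<le> c"
      unfolding c_def using I i by simp
    then show "c-lipschitz_on UNIV (\<tau> i)"
      using C(2)[OF i] lipschitz_on_mono by blast
    show "\<bar>\<tau> i 0\<bar> \<le> (1 - c) * R"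
      unfolding R_def using I i c by simp
  qed
qed

theorem proposition3p3:
  fixes I :: "'i set" and \<tau> :: "'i \<Rightarrow> real \<Rightarrow> real" and p :: "'i \<Rightarrow> real"
  assumes "contractive_ifs I \<tau>"
    and "\<And>i. i \<in> I \<Longrightarrow> 0 < p i \<and> p i < 1"
    and "(\<Sum>i\<in>I. p i) = 1"
  shows "(\<exists>!M. (M, M) \<in> moment_transform I p \<tau>) \<and>
    (borel_prob (hutchinson_measure I p \<tau>) \<and> has_all_moments (hutchinson_measure I p \<tau>) \<and>
     moment_matrix (hutchinson_op I p \<tau> (hutchinson_measure I p \<tau>)) =
       moment_matrix (hutchinson_measure I p \<tau>) \<and>
     (\<forall>M. (M, M) \<in> moment_transform I p \<tau> \<longleftrightarrow> M = moment_matrix (hutchinson_measure I p \<tau>))) \<and>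
    (\<forall>\<nu>. borel_prob \<nu> \<and> regular_borel \<nu> \<and> emeasure \<nu> (- attractor I \<tau>) = 0 \<longrightarrow>
       (\<forall>n. (moment_transform I p \<tau> ^^ n) `` {moment_matrix \<nu>} =
              {moment_matrix ((hutchinson_op I p \<tau> ^^ n) \<nu>)}) \<and>
       (\<forall>i j. (\<lambda>n. moment_matrix ((hutchinson_op I p \<tau> ^^ n) \<nu>) i j)
                \<longlonglongrightarrow> moment_matrix (hutchinson_measure I p \<tau>) i j))"
proof -
  have "I \<noteq> {}"
    using assms(3) by auto
  then obtain c R where cR: "c < 1" "\<And>i. i \<in> I \<Longrightarrow> c-lipschitz_on UNIV (\<tau> i)"
    "\<And>i. i \<in> I \<Longrightarrow> \<bar>\<tau> i 0\<bar> \<le> (1 - c) * R"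
    by (rule contractive_ifs_imp_uniform[OF assms(1)]) blast
  interpret contractive_real_ifs I p \<tau> c R
    by unfold_locales (use assms cR in \<open>auto simp: contractive_ifs_def less_imp_le\<close>)
  note \<mu> = real_distribution_coding_measure AE_coding_measure
  show ?thesis
    \<comment> \<open>After this rewriting, unique existence reads
      \<open>\<exists>!M. M = moment_matrix coding_measure\<close>, and the description of all fixed
      points becomes trivial.\<close>
    unfolding hutchinson_measure_eq moment_transform_fixed_iff borel_prob_iff
  proof (intro conjI allI impI; (elim conjE)?)
    show "has_all_moments coding_measure"
      by (rule has_all_moments_bounded[OF \<mu>])
    show "moment_matrix (S coding_measure) = moment_matrix coding_measure"
      by (simp add: S_coding_measure)
    fix \<nu> :: "real measure"
    assume "real_distribution \<nu>" "emeasure \<nu> (- attractor I \<tau>) = 0"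
    note \<nu> = this(1) AE_abs_le_if_supported[OF this]
    show "(moment_transform I p \<tau> ^^ n) `` {moment_matrix \<nu>} = {moment_matrix ((S ^^ n) \<nu>)}" for n
      by (rule moment_transform_relpow_Image[OF \<nu>])
    show "(\<lambda>n. moment_matrix ((S ^^ n) \<nu>) i j) \<longlonglongrightarrow> moment_matrix coding_measure i j" for i j
      unfolding moment_matrix_def by (rule moments_iterate_S_tendsto[OF \<nu> \<mu> S_coding_measure])
  qed (rule ex1_eq real_distribution_coding_measure refl)+
qed

end
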